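(* Let $M$ be a commutative monoid and let $X$ and $Y$ be left $M$-sets. The map $X\overset{M}{\wedge} Y\to X\otimes_M Y$ given by the assignment $$[x,y]\mapsto [1,x,y]$$ is an isomorphism of $M$-sets.
   Context: For a monoid $M$, a right $M$-set $X$ and a left $M$-set $Y$, the contracted product $X\overset{M}{\wedge}Y$ is the quotient of $X\times Y$ by the equivalence relation generated by $(x\cdot m,y)\sim(x,m\cdot y)$; $[x,y]$ denotes the class of $(x,y)$. When $M$ is commutative, a left $M$-set is also regarded as a right $M$-set (by $x\cdot m=m\cdot x$), and $X\overset{M}{\wedge}Y$ is an $M$-set via $m\cdot[x,y]=[m\cdot x,y]$. For a monoid homomorphism $f\colon M\to N$ and a left $M$-set $X$, $f_!(X)=N\overset{M}{\wedge}X$, where $N$ is a right $M$-set via $n\cdot m=nf(m)$, with left $N$-action $\bar n\cdot[n,x]=[\bar n n,x]$. For a commutative monoid $M$ with multiplication $p\colon M\times M\to M$ (a monoid homomorphism) and left $M$-sets $X,Y$, the product $X\times Y$ is a left $(M\times M)$-set with componentwise action, and $X\otimes_M Y:=p_!(X\times Y)=M\overset{M\times M}{\wedge}(X\times Y)$; $[m,x,y]$ denotes the class of $(m,(x,y))$. This is the tensor product on the fibre over $M$ of the forgetful functor from monoid left actions to monoids. *)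

theory Defs
  imports "HOL-Algebra.Group"
begin

text \<open>
  Monoids are HOL-Algebra monoids with an explicit carrier, and acted-on sets are explicit
  carriers too, so that empty sets with an action are included.
\<close>

record ('a, 'x) lset = "'x partial_object" +
  act :: "'a \<Rightarrow> 'x \<Rightarrow> 'x"

record ('a, 'x) rset = "'x partial_object" +
  ract :: "'x \<Rightarrow> 'a \<Rightarrow> 'x"

locale left_mset = monoid M for M (structure) +
  fixes X :: "('a, 'x) lset"
  assumes act_closed: "\<lbrakk>a \<in> carrier M; x \<in> carrier X\<rbrakk> \<Longrightarrow> act X a x \<in> carrier X"
    and act_one: "x \<in> carrier X \<Longrightarrow> act X \<one> x = x"
    and act_mult: "\<lbrakk>a \<in> carrier M; b \<in> carrier M; x \<in> carrier X\<rbrakk>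
      \<Longrightarrow> act X (a \<otimes> b) x = act X a (act X b x)"

locale mset_iso = dom: left_mset M X + cod: left_mset M Y
  for M (structure) and X :: "('a, 'x) lset" and Y :: "('a, 'y) lset" +
  fixes h :: "'x \<Rightarrow> 'y"
  assumes bij: "bij_betw h (carrier X) (carrier Y)"
    and equivariant: "\<lbrakk>a \<in> carrier M; x \<in> carrier X\<rbrakk> \<Longrightarrow> h (act X a x) = act Y a (h x)"

definition gen_equiv :: "'x set \<Rightarrow> ('x \<times> 'x) set \<Rightarrow> ('x \<times> 'x) set" where
  "gen_equiv S R = \<Inter> {E. equiv S E \<and> R \<subseteq> E}"

definition cp_rel ::
  "('a, 'b) monoid_scheme \<Rightarrow> ('a, 'x) rset \<Rightarrow> ('a, 'y) lset \<Rightarrow> (('x \<times> 'y) \<times> ('x \<times> 'y)) set" where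
  "cp_rel M X Y = gen_equiv (carrier X \<times> carrier Y)
     {((ract X x m, y), (x, act Y m y)) | x m y. x \<in> carrier X \<and> m \<in> carrier M \<and> y \<in> carrier Y}"

definition cp_class ::
  "('a, 'b) monoid_scheme \<Rightarrow> ('a, 'x) rset \<Rightarrow> ('a, 'y) lset \<Rightarrow> 'x \<Rightarrow> 'y \<Rightarrow> ('x \<times> 'y) set" where
  "cp_class M X Y x y = cp_rel M X Y `` {(x, y)}"

definition cp_carrier ::
  "('a, 'b) monoid_scheme \<Rightarrow> ('a, 'x) rset \<Rightarrow> ('a, 'y) lset \<Rightarrow> ('x \<times> 'y) set set" where
  "cp_carrier M X Y = (carrier X \<times> carrier Y) // cp_rel M X Y"

text \<open>
  If \<open>l\<close> is a left action (of a possibly different monoid) on \<open>X\<close> commuting with the right action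
  of \<open>M\<close>, then \<open>l\<close> descends to the contracted product by \<open>n \<cdot> [x, y] = [n \<cdot> x, y]\<close>.  As in
  \<^theory>\<open>HOL.Equiv_Relations\<close>, the induced operation is the union of the classes \<open>[n \<cdot> x, y]\<close> over
  all representatives \<open>(x, y)\<close>; these classes coincide when \<open>l\<close> commutes with the right action.
\<close>

definition cp_lset ::
  "('a, 'b) monoid_scheme \<Rightarrow> ('a, 'x) rset \<Rightarrow> ('a, 'y) lset \<Rightarrow> ('n \<Rightarrow> 'x \<Rightarrow> 'x)
    \<Rightarrow> ('n, ('x \<times> 'y) set) lset" where
  "cp_lset M X Y l =
     \<lparr>carrier = cp_carrier M X Y, act = (\<lambda>n c. \<Union>(x, y)\<in>c. cp_class M X Y (l n x) y)\<rparr>"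

definition as_rset :: "('a, 'x) lset \<Rightarrow> ('a, 'x) rset" where
  "as_rset X = \<lparr>carrier = carrier X, ract = (\<lambda>x m. act X m x)\<rparr>"

definition wedge ::
  "('a, 'b) monoid_scheme \<Rightarrow> ('a, 'x) lset \<Rightarrow> ('a, 'y) lset \<Rightarrow> ('a, ('x \<times> 'y) set) lset" where
  "wedge M X Y = cp_lset M (as_rset X) Y (act X)"

definition wedge_class ::
  "('a, 'b) monoid_scheme \<Rightarrow> ('a, 'x) lset \<Rightarrow> ('a, 'y) lset \<Rightarrow> 'x \<Rightarrow> 'y \<Rightarrow> ('x \<times> 'y) set" where
  "wedge_class M X Y x y = cp_class M (as_rset X) Y x y"

definition restr_rset :: "('n, 'c) monoid_scheme \<Rightarrow> ('a \<Rightarrow> 'n) \<Rightarrow> ('a, 'n) rset" where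
  "restr_rset N f = \<lparr>carrier = carrier N, ract = (\<lambda>n m. n \<otimes>\<^bsub>N\<^esub> f m)\<rparr>"

text \<open>The left action on \<open>f\<^sub>!(X) = N \<and>\<^sup>M X\<close> is induced by left multiplication in \<open>N\<close>.\<close>

definition extension ::
  "('a, 'b) monoid_scheme \<Rightarrow> ('n, 'c) monoid_scheme \<Rightarrow> ('a \<Rightarrow> 'n) \<Rightarrow> ('a, 'x) lset
    \<Rightarrow> ('n, ('n \<times> 'x) set) lset" where
  "extension M N f X = cp_lset M (restr_rset N f) X (mult N)"

definition extension_class ::
  "('a, 'b) monoid_scheme \<Rightarrow> ('n, 'c) monoid_scheme \<Rightarrow> ('a \<Rightarrow> 'n) \<Rightarrow> ('a, 'x) lset
    \<Rightarrow> 'n \<Rightarrow> 'x \<Rightarrow> ('n \<times> 'x) set" where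
  "extension_class M N f X n x = cp_class M (restr_rset N f) X n x"

definition prod_lset :: "('a, 'x) lset \<Rightarrow> ('b, 'y) lset \<Rightarrow> ('a \<times> 'b, 'x \<times> 'y) lset" where
  "prod_lset X Y =
     \<lparr>carrier = carrier X \<times> carrier Y, act = (\<lambda>(a, b) (x, y). (act X a x, act Y b y))\<rparr>"

definition mult_map :: "('a, 'b) monoid_scheme \<Rightarrow> 'a \<times> 'a \<Rightarrow> 'a" where
  "mult_map M = (\<lambda>(a, b). a \<otimes>\<^bsub>M\<^esub> b)"

definition tensor ::
  "('a, 'b) monoid_scheme \<Rightarrow> ('a, 'x) lset \<Rightarrow> ('a, 'y) lset
    \<Rightarrow> ('a, ('a \<times> ('x \<times> 'y)) set) lset" where
  "tensor M X Y = extension (M \<times>\<times> M) M (mult_map M) (prod_lset X Y)"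

definition tensor_class ::
  "('a, 'b) monoid_scheme \<Rightarrow> ('a, 'x) lset \<Rightarrow> ('a, 'y) lset \<Rightarrow> 'a \<Rightarrow> 'x \<Rightarrow> 'y
    \<Rightarrow> ('a \<times> ('x \<times> 'y)) set" where
  "tensor_class M X Y m x y = extension_class (M \<times>\<times> M) M (mult_map M) (prod_lset X Y) m (x, y)"

end

theory Submission
  imports Defs
begin

text \<open>
  Modulo the relations defining the tensor product, a scalar can be moved into either factor:
  \<open>[1, m x, y] = [m, x, y] = [1, x, m y]\<close>.  This makes \<open>[x, y] \<mapsto> [1, x, y]\<close> well defined and
  equivariant, and shows that \<open>[m, x, y] \<mapsto> [m x, y]\<close> is its inverse.
\<close>

lemma gen_equiv_least: "\<lbrakk>equiv S E; R \<subseteq> E\<rbrakk> \<Longrightarrow> gen_equiv S R \<subseteq> E"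
  unfolding gen_equiv_def by blast

lemma gen_equiv_incl: "R \<subseteq> gen_equiv S R"
  unfolding gen_equiv_def by blast

text \<open>The hypothesis makes \<open>S \<times> S\<close> a member of the intersected family,
  which bounds the intersection by \<open>S \<times> S\<close>; reflexivity, symmetry and
  transitivity pass to intersections.\<close>

lemma equiv_gen_equiv:
  assumes "R \<subseteq> S \<times> S"
  shows "equiv S (gen_equiv S R)"
proof (rule equivI)
  have "equiv S (S \<times> S)"
    by (auto intro!: equivI refl_onI symI transI)
  then show "gen_equiv S R \<subseteq> S \<times> S"
    using assms by (rule gen_equiv_least)
  show "refl_on S (gen_equiv S R)"
    unfolding gen_equiv_def by (auto simp: equiv_def intro!: refl_onI dest: refl_onD)
  show "sym (gen_equiv S R)"
    unfolding gen_equiv_def by (auto simp: equiv_def intro!: symI dest: symD)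
  show "trans (gen_equiv S R)"
    unfolding gen_equiv_def by (rule transI) (auto simp: equiv_def dest: transD)
qed

text \<open>The kernel of \<open>f\<close> on \<open>S\<close> is an equivalence relation containing
  \<open>R\<close>, hence it contains the least one.\<close>

lemma gen_equiv_invariant:
  assumes "R \<subseteq> S \<times> S" and "\<And>a b. (a, b) \<in> R \<Longrightarrow> f a = f b" and "(a, b) \<in> gen_equiv S R"
  shows "f a = f b"
proof -
  have "equiv S {(a, b) \<in> S \<times> S. f a = f b}"
    by (auto intro!: equivI refl_onI symI transI)
  then have "gen_equiv S R \<subseteq> {(a, b) \<in> S \<times> S. f a = f b}"
    using assms by (intro gen_equiv_least) auto
  then show ?thesis
    using assms(3) by auto
qed

text \<open>Closure of both actions places the generating pairs inside
  \<open>carrier X \<times> carrier Y\<close>, so that \<open>cp_rel\<close> is an equivalence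
  relation. The wedge and the tensor product are both instances.\<close>

locale contracted_product =
  fixes M :: "('a, 'b) monoid_scheme" and X :: "('a, 'x) rset" and Y :: "('a, 'y) lset"
  assumes ract_closed: "\<lbrakk>x \<in> carrier X; m \<in> carrier M\<rbrakk> \<Longrightarrow> ract X x m \<in> carrier X"
    and act_closed: "\<lbrakk>m \<in> carrier M; y \<in> carrier Y\<rbrakk> \<Longrightarrow> act Y m y \<in> carrier Y"
begin

lemma equiv_cp_rel: "equiv (carrier X \<times> carrier Y) (cp_rel M X Y)"
  unfolding cp_rel_def by (rule equiv_gen_equiv) (auto simp: ract_closed act_closed)

lemma cp_class_balanced:
  assumes "x \<in> carrier X" and "m \<in> carrier M" and "y \<in> carrier Y"
  shows "cp_class M X Y (ract X x m) y = cp_class M X Y x (act Y m y)"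
proof -
  have "((ract X x m, y), (x, act Y m y)) \<in> cp_rel M X Y"
    unfolding cp_rel_def using assms by (intro subsetD[OF gen_equiv_incl]) blast
  then show ?thesis
    unfolding cp_class_def by (rule equiv_class_eq[OF equiv_cp_rel])
qed

lemma cp_class_closed:
  "\<lbrakk>x \<in> carrier X; y \<in> carrier Y\<rbrakk> \<Longrightarrow> cp_class M X Y x y \<in> carrier (cp_lset M X Y l)"
  by (auto simp: cp_class_def cp_lset_def cp_carrier_def intro!: quotientI)

lemma cp_carrier_cases:
  assumes "c \<in> carrier (cp_lset M X Y l)"
  obtains x y where "x \<in> carrier X" and "y \<in> carrier Y" and "c = cp_class M X Y x y"
  using assms by (auto simp: cp_class_def cp_lset_def cp_carrier_def elim!: quotientE)

text \<open>This is how maps out of a contracted product are built: a balanced set-valued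
  \<open>f\<close> is constant on each class, and classes are nonempty, so the union over a class is
  the common value.\<close>

lemma UN_cp_class:
  assumes "\<And>x m y. \<lbrakk>x \<in> carrier X; m \<in> carrier M; y \<in> carrier Y\<rbrakk>
      \<Longrightarrow> f (ract X x m) y = f x (act Y m y)"
    and "x \<in> carrier X" and "y \<in> carrier Y"
  shows "(\<Union>(x, y)\<in>cp_class M X Y x y. f x y) = f x y"
proof -
  have "case_prod f p = f x y" if "p \<in> cp_class M X Y x y" for p
  proof -
    have "case_prod f (x, y) = case_prod f p"
    proof (rule gen_equiv_invariant[where f = "case_prod f"])
      show "((x, y), p) \<in> gen_equiv (carrier X \<times> carrier Y)
          {((ract X x m, y), (x, act Y m y)) | x m y.
            x \<in> carrier X \<and> m \<in> carrier M \<and> y \<in> carrier Y}"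
        using that by (simp add: cp_class_def cp_rel_def)
    qed (auto simp: ract_closed act_closed assms(1))
    then show ?thesis
      by simp
  qed
  moreover have "(x, y) \<in> cp_class M X Y x y"
    unfolding cp_class_def using assms(2,3) by (intro equiv_class_self[OF equiv_cp_rel]) simp
  ultimately show ?thesis
    by blast
qed

text \<open>Commutation with the right action makes \<open>[l n x, y]\<close> balanced in
  \<open>x\<close> and \<open>y\<close>:
  \<open>[l n (x m), y] = [(l n x) m, y] = [l n x, m y]\<close>.\<close>

lemma act_cp_class:
  assumes "\<And>x. x \<in> carrier X \<Longrightarrow> l n x \<in> carrier X"
    and "\<And>x m. \<lbrakk>x \<in> carrier X; m \<in> carrier M\<rbrakk> \<Longrightarrow> l n (ract X x m) = ract X (l n x) m"
    and "x \<in> carrier X" and "y \<in> carrier Y"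
  shows "act (cp_lset M X Y l) n (cp_class M X Y x y) = cp_class M X Y (l n x) y"
  using UN_cp_class[of "\<lambda>x y. cp_class M X Y (l n x) y" x y] assms
  by (simp add: cp_lset_def cp_class_balanced)

text \<open>Every element is the class of a pair, and on such classes the action only changes the
  first entry; each law thus reduces to the same law for \<open>l\<close>.\<close>

lemma left_mset_cp_lset:
  fixes N :: "('n, 'c) monoid_scheme" (structure)
  assumes N: "monoid N"
    and closed: "\<And>n x. \<lbrakk>n \<in> carrier N; x \<in> carrier X\<rbrakk> \<Longrightarrow> l n x \<in> carrier X"
    and one: "\<And>x. x \<in> carrier X \<Longrightarrow> l \<one> x = x"
    and mult: "\<And>n k x. \<lbrakk>n \<in> carrier N; k \<in> carrier N; x \<in> carrier X\<rbrakk>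
      \<Longrightarrow> l (n \<otimes> k) x = l n (l k x)"
    and commute: "\<And>n x m. \<lbrakk>n \<in> carrier N; x \<in> carrier X; m \<in> carrier M\<rbrakk>
      \<Longrightarrow> l n (ract X x m) = ract X (l n x) m"
  shows "left_mset N (cp_lset M X Y l)"
proof -
  interpret monoid N by fact
  have act: "act (cp_lset M X Y l) n (cp_class M X Y x y) = cp_class M X Y (l n x) y"
    if "n \<in> carrier N" "x \<in> carrier X" "y \<in> carrier Y" for n x y
    using that closed commute by (simp add: act_cp_class)
  show ?thesis
    by unfold_locales
      (auto elim!: cp_carrier_cases simp: act closed one mult intro!: cp_class_closed)
qed

end

lemma (in left_mset) contracted_product_as_rset:
  assumes "left_mset M Y"
  shows "contracted_product M (as_rset X) Y"
  using left_mset.act_closed[OF assms]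
  by unfold_locales (auto simp: as_rset_def act_closed)

lemma (in left_mset) contracted_product_tensor:
  assumes "left_mset M Y"
  shows "contracted_product (M \<times>\<times> M) (restr_rset M (mult_map M)) (prod_lset X Y)"
  using left_mset.act_closed[OF assms]
  by unfold_locales (auto simp: restr_rset_def mult_map_def prod_lset_def act_closed)

theorem proposition6p3:
  fixes M :: "('a, 'b) monoid_scheme" (structure)
    and X :: "('a, 'x) lset" and Y :: "('a, 'y) lset"
  assumes "comm_monoid M" and "left_mset M X" and "left_mset M Y"
  shows "\<exists>\<phi>. (\<forall>x\<in>carrier X. \<forall>y\<in>carrier Y. \<phi> (wedge_class M X Y x y) = tensor_class M X Y \<one> x y)
    \<and> mset_iso M (wedge M X Y) (tensor M X Y) \<phi>"
proof -
  interpret comm_monoid M by fact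
  interpret X: left_mset M X by fact
  interpret Y: left_mset M Y by fact
  interpret W: contracted_product M "as_rset X" Y
    using assms(3) by (rule X.contracted_product_as_rset)
  interpret T: contracted_product "M \<times>\<times> M" "restr_rset M (mult_map M)" "prod_lset X Y"
    using assms(3) by (rule X.contracted_product_tensor)
  note W_simps = as_rset_def wedge_def wedge_class_def
  note T_simps = restr_rset_def mult_map_def prod_lset_def tensor_def tensor_class_def
    extension_def extension_class_def
  \<comment> \<open>The right action of \<open>as_rset X\<close> is \<open>act X\<close> itself, so
    this is the commutation of left and right actions that the action on the wedge requires.\<close>
  have X_commute: "act X a (act X b x) = act X b (act X a x)"
    if "a \<in> carrier M" "b \<in> carrier M" "x \<in> carrier X" for a b x
    using that by (metis X.act_mult m_comm)

  have W_mset: "left_mset M (wedge M X Y)"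
    unfolding wedge_def
    by (rule W.left_mset_cp_lset)
      (auto simp: as_rset_def X.act_closed X.act_one X.act_mult X_commute monoid_axioms)
  have T_mset: "left_mset M (tensor M X Y)"
    unfolding tensor_def extension_def
    by (rule T.left_mset_cp_lset)
      (auto simp: restr_rset_def mult_map_def m_assoc monoid_axioms)

  have W_closed: "wedge_class M X Y x y \<in> carrier (wedge M X Y)"
    if "x \<in> carrier X" "y \<in> carrier Y" for x y
    using that W.cp_class_closed[of x y] by (simp add: W_simps)
  have W_cases: "\<exists>x\<in>carrier X. \<exists>y\<in>carrier Y. c = wedge_class M X Y x y"
    if "c \<in> carrier (wedge M X Y)" for c
    using that unfolding wedge_def by (rule W.cp_carrier_cases) (auto simp: W_simps)
  have W_balanced: "wedge_class M X Y (act X a x) y = wedge_class M X Y x (act Y a y)"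
    if "a \<in> carrier M" "x \<in> carrier X" "y \<in> carrier Y" for a x y
    using that W.cp_class_balanced[of x a y] by (simp add: W_simps)
  have W_act: "act (wedge M X Y) a (wedge_class M X Y x y) = wedge_class M X Y (act X a x) y"
    if "a \<in> carrier M" "x \<in> carrier X" "y \<in> carrier Y" for a x y
    using that W.act_cp_class[of "act X" a x y] by (simp add: W_simps X.act_closed X_commute)

  have T_closed: "tensor_class M X Y m x y \<in> carrier (tensor M X Y)"
    if "m \<in> carrier M" "x \<in> carrier X" "y \<in> carrier Y" for m x y
    using that T.cp_class_closed[of m "(x, y)"] by (simp add: T_simps)
  have T_cases: "\<exists>m\<in>carrier M. \<exists>x\<in>carrier X. \<exists>y\<in>carrier Y. c = tensor_class M X Y m x y"
    if "c \<in> carrier (tensor M X Y)" for c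
    using that unfolding tensor_def extension_def
    by (rule T.cp_carrier_cases) (auto simp: T_simps)
  have T_balanced: "tensor_class M X Y (m \<otimes> (a \<otimes> b)) x y
      = tensor_class M X Y m (act X a x) (act Y b y)"
    if "m \<in> carrier M" "a \<in> carrier M" "b \<in> carrier M" "x \<in> carrier X" "y \<in> carrier Y"
    for m a b x y
    using that T.cp_class_balanced[of m "(a, b)" "(x, y)"] by (simp add: T_simps)
  have T_act: "act (tensor M X Y) a (tensor_class M X Y m x y) = tensor_class M X Y (a \<otimes> m) x y"
    if "a \<in> carrier M" "m \<in> carrier M" "x \<in> carrier X" "y \<in> carrier Y" for a m x y
    using that T.act_cp_class[of "mult M" a m "(x, y)"] by (auto simp: T_simps m_assoc)

  \<comment> \<open>The pairs \<open>(m, \<one>)\<close> and \<open>(\<one>, m)\<close> of the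
    product monoid both multiply to \<open>m\<close>, but they act on different factors; this gives
    \<open>T_left\<close> and \<open>T_right\<close>.\<close>
  have T_left: "tensor_class M X Y \<one> (act X m x) y = tensor_class M X Y m x y"
    if "m \<in> carrier M" "x \<in> carrier X" "y \<in> carrier Y" for m x y
    using that T_balanced[of \<one> m \<one> x y] by (simp add: Y.act_one)
  have T_right: "tensor_class M X Y \<one> x (act Y m y) = tensor_class M X Y m x y"
    if "m \<in> carrier M" "x \<in> carrier X" "y \<in> carrier Y" for m x y
    using that T_balanced[of \<one> \<one> m x y] by (simp add: X.act_one)

  \<comment> \<open>Both maps take values in classes, which are sets, so a union over
    representatives defines them and \<open>UN_cp_class\<close> evaluates them.\<close>
  define \<phi> where "\<phi> = (\<lambda>c. \<Union>(x, y)\<in>c. tensor_class M X Y \<one> x y)"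
  define \<psi> where "\<psi> = (\<lambda>c. \<Union>(m, z)\<in>c. case z of (x, y) \<Rightarrow> wedge_class M X Y (act X m x) y)"
  have \<phi>: "\<phi> (wedge_class M X Y x y) = tensor_class M X Y \<one> x y"
    if "x \<in> carrier X" "y \<in> carrier Y" for x y
    unfolding \<phi>_def wedge_class_def using that
    by (intro W.UN_cp_class) (auto simp: as_rset_def T_left T_right)
  have \<psi>_balanced: "wedge_class M X Y (act X (m \<otimes> (a \<otimes> b)) x) y
      = wedge_class M X Y (act X m (act X a x)) (act Y b y)"
    if "m \<in> carrier M" "a \<in> carrier M" "b \<in> carrier M" "x \<in> carrier X" "y \<in> carrier Y"
    for m a b x y
  proof -
    \<comment> \<open>With \<open>b\<close> outermost, \<open>W_balanced\<close> carries the scalars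
      over to the second factor in the same order on both sides of the goal.\<close>
    have "act X (m \<otimes> (a \<otimes> b)) x = act X b (act X m (act X a x))"
      using that by (simp add: X.act_mult X.act_closed X_commute)
    then show ?thesis
      using that by (simp add: W_balanced X.act_closed)
  qed
  have \<psi>: "\<psi> (tensor_class M X Y m x y) = wedge_class M X Y (act X m x) y"
    if "m \<in> carrier M" "x \<in> carrier X" "y \<in> carrier Y" for m x y
    unfolding \<psi>_def tensor_class_def extension_class_def using that
    by (subst T.UN_cp_class) (auto simp: restr_rset_def mult_map_def prod_lset_def \<psi>_balanced)

  \<comment> \<open>On representatives, \<open>\<psi>\<close> after \<open>\<phi>\<close> gives
    \<open>[\<one> x, y] = [x, y]\<close>, and \<open>\<phi>\<close> after \<open>\<psi>\<close>
    gives \<open>[\<one>, m x, y]\<close>, which is \<open>[m, x, y]\<close> by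
    \<open>T_left\<close>.\<close>
  have bij: "bij_betw \<phi> (carrier (wedge M X Y)) (carrier (tensor M X Y))"
    by (rule bij_betw_byWitness[where f' = \<psi>])
      (auto dest!: W_cases T_cases
        simp: \<phi> \<psi> T_left X.act_one X.act_closed intro!: W_closed T_closed)
  \<comment> \<open>For \<open>c = [x, y]\<close> both sides equal \<open>[a, x, y]\<close>: the
    left one is \<open>[\<one>, a x, y]\<close>, the right one
    \<open>[a \<otimes> \<one>, x, y]\<close>.\<close>
  have equivariant: "\<phi> (act (wedge M X Y) a c) = act (tensor M X Y) a (\<phi> c)"
    if "a \<in> carrier M" "c \<in> carrier (wedge M X Y)" for a c
    using that by (auto dest!: W_cases simp: W_act T_act \<phi> T_left X.act_closed)
  have "mset_iso M (wedge M X Y) (tensor M X Y) \<phi>"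
    by (intro mset_iso.intro mset_iso_axioms.intro W_mset T_mset bij equivariant)
  then show ?thesis
    using \<phi> by blast
qed

end
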